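(* Let $\mathbb{R}_+=(0,\infty)$ and let $f\in C^\infty(\mathbb{R}_+^2,\mathbb{C})$ be homogeneous of order $d\in\mathbb{C}$ jointly in both variables $(z,n)$, and suppose that as $z\to\infty$, respectively $n\to\infty$, $$f(z,1)=\sum_{j=1}^{N-1}\sum_{k=0}^{M_j}a_{jk}z^{\alpha_j}\log^k(z)+\sum_{k=0}^{M_0}a_{0k}\log^k(z)+o(z^{\alpha_N}\log^{M_N}(z)),$$ $$f(1,n)=\sum_{j=1}^{N'-1}\sum_{k=0}^{M'_j}b_{jk}n^{\beta_j}\log^k(n)+\sum_{k=0}^{M'_0}b_{0k}\log^k(n)+o(n^{\beta_{N'}}\log^{M'_{N'}}(n)),$$ for some $N,N'\in\mathbb{N}$ and $(\alpha_j),(\beta_j)\subset\mathbb{C}$ such that $(\mathrm{Re}(\alpha_j))$ and $(\mathrm{Re}(\beta_j))$ are monotonously decreasing sequences with $\mathrm{Re}(\alpha_N)<-1$ and $\mathrm{Re}(\beta_{N'})<\min\{0,\mathrm{Re}(d)+1\}$. Then all regularized limits and regularized integrals in the following identity exist, and $$\operatorname*{LIM}_{n\to\infty}\ \mathrm{reg}\!\!\int_1^\infty f(z,n)\,dz=\mathrm{reg}\!\!\int_1^\infty\operatorname*{LIM}_{n\to\infty}f(z,n)\,dz+\mathrm{Corr},$$ where $\mathrm{Corr}=\mathrm{reg}\!\int_0^\infty f(z,1)\,dz$ if $d=-1$, and $\mathrm{Corr}=0$ otherwise.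
   Context: Homogeneity of order $d$ means $f(tz,tn)=t^df(z,n)$ for all $t,z,n>0$. In the expansions $M_j,M'_j\in\mathbb{N}_0$, $a_{jk},b_{jk}\in\mathbb{C}$, and the exponents $\alpha_j,\beta_j$ with $j\ge1$ are non-zero. Regularized limit: suppose that, as $x\to\infty$, $$g(x)=\sum_{j=1}^{N-1}\sum_{k=0}^{M_j}a_{jk}x^{\alpha_j}\log^k(x)+\sum_{k=0}^{M_0}a_{0k}\log^k(x)+o(x^{\alpha_N}\log^{M_N}(x))$$ with $\alpha_j\ne0$ for $j\ge1$, with $(\mathrm{Re}(\alpha_j))$ monotonously decreasing and $\mathrm{Re}(\alpha_N)<0$. Then $\operatorname*{LIM}_{x\to\infty}g(x):=a_{00}$. The regularized limit $\operatorname*{LIM}_{x\to0}$ is defined in the same way as the coefficient of $x^0\log^0(x)$ in an expansion of this form as $x\to0$, with $(\mathrm{Re}(\alpha_j))$ monotonously increasing and $\mathrm{Re}(\alpha_N)>0$. Regularized integral: $\mathrm{reg}\!\int_1^\infty g(x)\,dx:=\operatorname*{LIM}_{R\to\infty}\int_1^Rg(x)\,dx$, $\mathrm{reg}\!\int_0^1g(x)\,dx:=\operatorname*{LIM}_{\varepsilon\to0}\int_\varepsilon^1g(x)\,dx$, and $\mathrm{reg}\!\int_0^\infty:=\mathrm{reg}\!\int_0^1+\mathrm{reg}\!\int_1^\infty$ (Hadamard partie finie). *)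

theory Defs
  imports "HOL-Analysis.Analysis" "HOL-Library.Landau_Symbols"
begin

text \<open>
  Continuous differentiability of order \<open>k\<close> on an open subset of a finite-dimensional space:
  all iterated directional derivatives up to order \<open>k\<close> exist and are continuous. The Frechet
  derivative is taken at the points of \<open>S\<close> without restricting to \<open>S\<close>, so \<open>S\<close> has to be open.
\<close>

primrec Ck_on :: "nat \<Rightarrow> 'a::euclidean_space set \<Rightarrow> ('a \<Rightarrow> 'b::real_normed_vector) \<Rightarrow> bool" where
  "Ck_on 0 S f \<longleftrightarrow> continuous_on S f"
| "Ck_on (Suc k) S f \<longleftrightarrow> (\<forall>x\<in>S. f differentiable (at x)) \<and>
     (\<forall>v. Ck_on k S (\<lambda>x. frechet_derivative f (at x) v))"

definition smooth_on :: "'a::euclidean_space set \<Rightarrow> ('a \<Rightarrow> 'b::real_normed_vector) \<Rightarrow> bool" where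
  "smooth_on S f \<longleftrightarrow> (\<forall>k. Ck_on k S f)"

text \<open>
  \<open>has_log_expansion F g N \<alpha> M a\<close>: along the filter \<open>F\<close> on the positive reals (\<open>at_top\<close> or
  \<open>at_right 0\<close>), \<open>g x\<close> equals
  \<open>\<Sum>j=1..N-1. \<Sum>k\<le>M j. a j k * x^\<alpha> j * (ln x)^k\<close> plus \<open>\<Sum>k\<le>M 0. a 0 k * (ln x)^k\<close> up to an
  error in \<open>o(x^\<alpha> N * (ln x)^M N)\<close>. The index \<open>0\<close> stands for the exponent \<open>0\<close>; the value \<open>\<alpha> 0\<close>
  and all values beyond index \<open>N\<close> are irrelevant. The monotonicity of the real parts depends on
  the direction of the limit and is imposed separately; it is the weak one, so several
  exponents may share the same real part.
\<close>

definition has_log_expansion ::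
  "real filter \<Rightarrow> (real \<Rightarrow> complex) \<Rightarrow> nat \<Rightarrow> (nat \<Rightarrow> complex) \<Rightarrow> (nat \<Rightarrow> nat) \<Rightarrow>
     (nat \<Rightarrow> nat \<Rightarrow> complex) \<Rightarrow> bool" where
  "has_log_expansion F g N \<alpha> M a \<longleftrightarrow>
     1 \<le> N \<and> (\<forall>j\<in>{1..N}. \<alpha> j \<noteq> 0) \<and>
     (\<lambda>x. g x -
        ((\<Sum>j=1..N-1. \<Sum>k\<le>M j. a j k * complex_of_real x powr \<alpha> j * complex_of_real (ln x) ^ k)
         + (\<Sum>k\<le>M 0. a 0 k * complex_of_real (ln x) ^ k)))
     \<in> o[F](\<lambda>x. complex_of_real x powr \<alpha> N * complex_of_real (ln x) ^ M N)"

definition has_LIM_at_top :: "(real \<Rightarrow> complex) \<Rightarrow> complex \<Rightarrow> bool" where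
  "has_LIM_at_top g L \<longleftrightarrow>
     (\<exists>N \<alpha> M a. has_log_expansion at_top g N \<alpha> M a \<and>
        antimono_on {1..N} (\<lambda>j. Re (\<alpha> j)) \<and> Re (\<alpha> N) < 0 \<and> L = a 0 0)"

definition has_LIM_at_0 :: "(real \<Rightarrow> complex) \<Rightarrow> complex \<Rightarrow> bool" where
  "has_LIM_at_0 g L \<longleftrightarrow>
     (\<exists>N \<alpha> M a. has_log_expansion (at_right 0) g N \<alpha> M a \<and>
        mono_on {1..N} (\<lambda>j. Re (\<alpha> j)) \<and> Re (\<alpha> N) > 0 \<and> L = a 0 0)"

definition LIM_exists_at_top :: "(real \<Rightarrow> complex) \<Rightarrow> bool" where
  "LIM_exists_at_top g \<longleftrightarrow> (\<exists>L. has_LIM_at_top g L)"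

definition LIM_exists_at_0 :: "(real \<Rightarrow> complex) \<Rightarrow> bool" where
  "LIM_exists_at_0 g \<longleftrightarrow> (\<exists>L. has_LIM_at_0 g L)"

definition LIM_at_top :: "(real \<Rightarrow> complex) \<Rightarrow> complex" where
  "LIM_at_top g = (THE L. has_LIM_at_top g L)"

definition LIM_at_0 :: "(real \<Rightarrow> complex) \<Rightarrow> complex" where
  "LIM_at_0 g = (THE L. has_LIM_at_0 g L)"

text \<open>
  Existence of a regularized integral includes that the truncated integrals exist in the
  Lebesgue sense, since \<open>integral\<close> is \<open>0\<close> on non-integrable functions.
\<close>

definition reg_integrable_1_inf :: "(real \<Rightarrow> complex) \<Rightarrow> bool" where
  "reg_integrable_1_inf g \<longleftrightarrow>
     (\<forall>R\<ge>1. g absolutely_integrable_on {1..R}) \<and>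
     LIM_exists_at_top (\<lambda>R. integral {1..R} g)"

definition reg_integrable_0_1 :: "(real \<Rightarrow> complex) \<Rightarrow> bool" where
  "reg_integrable_0_1 g \<longleftrightarrow>
     (\<forall>\<epsilon>\<in>{0<..1}. g absolutely_integrable_on {\<epsilon>..1}) \<and>
     LIM_exists_at_0 (\<lambda>\<epsilon>. integral {\<epsilon>..1} g)"

definition reg_integrable_0_inf :: "(real \<Rightarrow> complex) \<Rightarrow> bool" where
  "reg_integrable_0_inf g \<longleftrightarrow> reg_integrable_0_1 g \<and> reg_integrable_1_inf g"

definition reg_integral_1_inf :: "(real \<Rightarrow> complex) \<Rightarrow> complex" where
  "reg_integral_1_inf g = LIM_at_top (\<lambda>R. integral {1..R} g)"

definition reg_integral_0_1 :: "(real \<Rightarrow> complex) \<Rightarrow> complex" where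
  "reg_integral_0_1 g = LIM_at_0 (\<lambda>\<epsilon>. integral {\<epsilon>..1} g)"

definition reg_integral_0_inf :: "(real \<Rightarrow> complex) \<Rightarrow> complex" where
  "reg_integral_0_inf g = reg_integral_0_1 g + reg_integral_1_inf g"

end

theory Submission
  imports Defs "HOL-Real_Asymp.Real_Asymp"
begin

text \<open>
  Let \<open>F\<close> be an antiderivative of \<open>u z = f (z, 1)\<close> on the positive reals. By homogeneity
  \<open>\<integral> f (z, n) dz\<close> over \<open>[1, R]\<close> is \<open>n^(d+1) * (F (R/n) - F (1/n))\<close>, whose regularized limit in \<open>R\<close>
  is \<open>n^(d+1) * (Q (- ln n) + W n)\<close> with a polynomial \<open>Q\<close> and \<open>W n = - F (1/n)\<close>. As \<open>W\<close> is an
  antiderivative of \<open>n^(-d-2) * f (1, n)\<close>, integrating the expansion of \<open>f (1, n)\<close> termwise gives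
  an expansion of \<open>n^(d+1) * W n\<close> up to one integration constant. The terms with a non-zero exponent
  \<open>\<beta> j\<close> reproduce that exponent and do not contribute to the limit. For
  \<open>d \<noteq> -1\<close>, \<open>Q\<close> and the integration constant are multiplied by \<open>n^(d+1)\<close> and drop out, and the terms
  \<open>(ln n)^k\<close> contribute the regularized integral of the pointwise limit. For \<open>d = -1\<close>, that integral is
  \<open>0\<close>, and the limit of \<open>Q (- ln n) + W n\<close> is the regularized integral of \<open>u\<close>.
\<close>

section \<open>Growth of complex powers and logarithms at infinity\<close>

abbreviation cpow :: "real \<Rightarrow> complex \<Rightarrow> complex" where
  "cpow x s \<equiv> complex_of_real x powr s"

abbreviation bigo_pow :: "(real \<Rightarrow> complex) \<Rightarrow> real \<Rightarrow> bool" where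
  "bigo_pow g e \<equiv> g \<in> O[at_top](\<lambda>x. complex_of_real (x powr e))"

lemma cpow_bigo: "bigo_pow (\<lambda>x. cpow x s) (Re s)"
proof (rule bigoI[of _ 1])
  show "eventually (\<lambda>x. norm (cpow x s) \<le> 1 * norm (complex_of_real (x powr Re s))) at_top"
    using eventually_gt_at_top[of 0]
    by eventually_elim (simp add: norm_powr_real_powr)
qed

lemma powr_smallo_powr:
  assumes "e < e'"
  shows "(\<lambda>x. complex_of_real (x powr e)) \<in> o[at_top](\<lambda>x. complex_of_real (x powr e'))"
  unfolding landau_o.small.of_real_iff using assms by real_asymp

lemma bigo_pow_mono: "bigo_pow g e \<Longrightarrow> e \<le> e' \<Longrightarrow> bigo_pow g e'"
  by (cases "e = e'") (auto intro: landau_o.big_trans[OF _ landau_o.small_imp_big[OF powr_smallo_powr]])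

lemma cpow_poly_ln_smallo:
  assumes "Re s < e"
  shows "(\<lambda>x. cpow x s * poly p (complex_of_real (ln x))) \<in> o[at_top](\<lambda>x. complex_of_real (x powr e))"
  using assms
proof (induction p arbitrary: e)
  case 0
  show ?case by simp
next
  case (pCons a p)
  \<comment> \<open>Multiplication by \<open>ln x\<close> costs an arbitrarily small power: the
    induction hypothesis is applied at an intermediate exponent \<open>e'\<close>, and the gap up to
    \<open>e\<close> absorbs the logarithm.\<close>
  obtain e' where e': "Re s < e'" "e' < e"
    using dense[OF pCons.prems] by blast
  have "(\<lambda>x. a * cpow x s) \<in> o[at_top](\<lambda>x. complex_of_real (x powr e))"
    using landau_o.big_small_trans[OF cpow_bigo powr_smallo_powr[OF pCons.prems]] by simp
  moreover have "(\<lambda>x. complex_of_real (ln x) * (cpow x s * poly p (complex_of_real (ln x))))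
      \<in> o[at_top](\<lambda>x. complex_of_real (ln x) * complex_of_real (x powr e'))"
    by (intro landau_o.big_small_mult pCons.IH e') simp
  moreover have "(\<lambda>x. complex_of_real (ln x * x powr e')) \<in> o[at_top](\<lambda>x. complex_of_real (x powr e))"
    unfolding landau_o.small.of_real_iff using e' by real_asymp
  ultimately have "(\<lambda>x. a * cpow x s + complex_of_real (ln x) * (cpow x s * poly p (complex_of_real (ln x))))
      \<in> o[at_top](\<lambda>x. complex_of_real (x powr e))"
    by (intro sum_in_smallo(1)) (auto intro: landau_o.small_trans)
  then show ?case
    by (simp add: algebra_simps)
qed

section \<open>Sums of powers times polynomials in the logarithm, and expansions in them\<close>

type_synonym logpoly = "(complex \<times> complex poly) list"

text \<open>Exponents in a \<open>logpoly\<close> may repeat and come in any order, so that addition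
  is \<open>@\<close> and the operations act entrywise. Hence several entries can contribute to
  \<open>zero_part\<close>.\<close>

definition lp :: "logpoly \<Rightarrow> real \<Rightarrow> complex" where
  "lp xs x = (\<Sum>(s, p)\<leftarrow>xs. cpow x s * poly p (complex_of_real (ln x)))"

definition zero_part :: "logpoly \<Rightarrow> complex poly" where
  "zero_part xs = (\<Sum>(s, p)\<leftarrow>xs. if s = 0 then p else 0)"

lemma lp_Nil [simp]: "lp [] x = 0"
  and lp_Cons [simp]: "lp ((s, p) # xs) x = cpow x s * poly p (complex_of_real (ln x)) + lp xs x"
  and lp_append [simp]: "lp (xs @ ys) x = lp xs x + lp ys x"
  by (simp_all add: lp_def)

lemma zero_part_Nil [simp]: "zero_part [] = 0"
  and zero_part_Cons [simp]: "zero_part ((s, p) # xs) = (if s = 0 then p else 0) + zero_part xs"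
  and zero_part_append [simp]: "zero_part (xs @ ys) = zero_part xs + zero_part ys"
  by (simp_all add: zero_part_def)

lemma lp_smallo:
  assumes "\<And>s p. (s, p) \<in> set xs \<Longrightarrow> Re s < e"
  shows "lp xs \<in> o[at_top](\<lambda>x. complex_of_real (x powr e))"
  using assms
proof (induction xs)
  case Nil
  then show ?case by (simp add: lp_def[abs_def])
next
  case (Cons y xs)
  obtain s p where y: "y = (s, p)" by (cases y)
  have "(\<lambda>x. cpow x s * poly p (complex_of_real (ln x)) + lp xs x) \<in> o[at_top](\<lambda>x. complex_of_real (x powr e))"
    using Cons by (intro sum_in_smallo(1) cpow_poly_ln_smallo Cons.IH) (auto simp: y)
  then show ?case by (simp add: y)
qed

lemma lp_partition: "lp xs x = lp (filter P xs) x + lp (filter (\<lambda>y. \<not> P y) xs) x"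
  by (induction xs) auto

lemma lp_split_zero:
  "x > 0 \<Longrightarrow> lp xs x = poly (zero_part xs) (complex_of_real (ln x)) + lp (filter (\<lambda>(s, p). s \<noteq> 0) xs) x"
  by (induction xs) (auto simp: algebra_simps)

definition lp_mult :: "complex \<Rightarrow> complex \<Rightarrow> logpoly \<Rightarrow> logpoly" where
  "lp_mult c w xs = map (\<lambda>(s, p). (s + w, smult c p)) xs"

text \<open>As \<open>ln (c * x) = ln c + ln x\<close>, a dilation of \<open>x\<close> translates
  the polynomial variable by \<open>ln c\<close>, besides giving the factor
  \<open>c^s\<close>.\<close>

definition lp_scale :: "real \<Rightarrow> logpoly \<Rightarrow> logpoly" where
  "lp_scale c xs = map (\<lambda>(s, p). (s, smult (cpow c s) (pcompose p [:complex_of_real (ln c), 1:]))) xs"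

lemma lp_lp_mult: "x > 0 \<Longrightarrow> lp (lp_mult c w xs) x = c * cpow x w * lp xs x"
  by (induction xs) (auto simp: lp_mult_def powr_add algebra_simps)

lemma lp_lp_scale:
  assumes "c > 0" "x > 0"
  shows "lp (lp_scale c xs) x = lp xs (c * x)"
  using assms by (induction xs) (auto simp: lp_scale_def poly_pcompose ln_mult powr_times_real algebra_simps)

lemma zero_part_lp_mult: "zero_part (lp_mult c 0 xs) = smult c (zero_part xs)"
  by (induction xs) (auto simp: lp_mult_def smult_add_right)

lemma zero_part_lp_scale: "c > 0 \<Longrightarrow> zero_part (lp_scale c xs) = pcompose (zero_part xs) [:complex_of_real (ln c), 1:]"
  by (induction xs) (auto simp: lp_scale_def pcompose_add)

text \<open>A pure power as error bound, without logarithms, keeps the calculus simple at the cost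
  of a slightly smaller decay rate. Entries of \<open>xs\<close> that decay faster than the error
  are harmless, so the exponents are unrestricted.\<close>

definition expn :: "(real \<Rightarrow> complex) \<Rightarrow> logpoly \<Rightarrow> real \<Rightarrow> bool" where
  "expn g xs \<eta> \<longleftrightarrow> bigo_pow (\<lambda>x. g x - lp xs x) (- \<eta>)"

lemma expn_cong:
  assumes "eventually (\<lambda>x. g x = h x) at_top" "expn h xs \<eta>"
  shows "expn g xs \<eta>"
  using assms(2) unfolding expn_def
  by (rule landau_o.big.in_cong[THEN iffD2, rotated])
     (use assms(1) in eventually_elim, simp)

lemma expn_mono: "expn g xs \<eta> \<Longrightarrow> \<eta>' \<le> \<eta> \<Longrightarrow> expn g xs \<eta>'"
  unfolding expn_def by (rule bigo_pow_mono) auto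

lemma expn_lp: "(\<And>x. x > 0 \<Longrightarrow> g x = lp xs x) \<Longrightarrow> expn g xs \<eta>"
  by (rule expn_cong[of _ "lp xs"])
     (auto simp: expn_def intro: eventually_mono[OF eventually_gt_at_top[of 0]])

lemma expn_add:
  assumes "expn g xs \<eta>" "expn h ys \<eta>"
  shows "expn (\<lambda>x. g x + h x) (xs @ ys) \<eta>"
  using sum_in_bigo(1)[OF assms[unfolded expn_def]] by (simp add: expn_def algebra_simps)

lemma expn_mult:
  assumes "expn g xs \<eta>"
  shows "expn (\<lambda>x. c * cpow x w * g x) (lp_mult c w xs) (\<eta> - Re w)"
proof -
  have "bigo_pow (\<lambda>x. (c * cpow x w) * (g x - lp xs x)) (- (\<eta> - Re w))"
  proof -
    have "(\<lambda>x. (c * cpow x w) * (g x - lp xs x))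
        \<in> O[at_top](\<lambda>x. complex_of_real (x powr Re w) * complex_of_real (x powr - \<eta>))"
      using assms cpow_bigo[of w] unfolding expn_def by (intro landau_o.big.mult) auto
    moreover have "- (\<eta> - Re w) = Re w + - \<eta>"
      by simp
    ultimately show ?thesis
      by (simp only: powr_add of_real_mult)
  qed
  then show ?thesis
    unfolding expn_def
    by (rule landau_o.big.in_cong[THEN iffD2, rotated])
       (use eventually_gt_at_top[of 0] in eventually_elim, simp add: lp_lp_mult algebra_simps)
qed

lemma bigo_pow_scale:
  assumes "c > 0" "bigo_pow g e"
  shows "bigo_pow (\<lambda>x. g (c * x)) e"
proof -
  have "filterlim (\<lambda>x::real. c * x) at_top at_top"
    using assms(1) by real_asymp
  from landau_o.big.compose[OF assms(2) this]
  have "(\<lambda>x. g (c * x)) \<in> O[at_top](\<lambda>x. complex_of_real ((c * x) powr e))" .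
  also have "(\<lambda>x. complex_of_real ((c * x) powr e)) \<in> O[at_top](\<lambda>x. complex_of_real (x powr e))"
    using assms(1) by (intro bigoI[of _ "c powr e"] always_eventually)
       (simp add: powr_mult norm_mult)
  finally show ?thesis .
qed

lemma expn_scale:
  assumes "c > 0" "expn g xs \<eta>"
  shows "expn (\<lambda>x. g (c * x)) (lp_scale c xs) \<eta>"
  using bigo_pow_scale[OF assms(1) assms(2)[unfolded expn_def]] unfolding expn_def
  by (rule landau_o.big.in_cong[THEN iffD2, rotated])
     (use eventually_gt_at_top[of 0] in eventually_elim, use assms(1) in \<open>simp add: lp_lp_scale\<close>)

section \<open>Uniqueness of the polynomial at exponent 0\<close>

lemma poly_ln_bigo_imp_0:
  assumes "bigo_pow (\<lambda>x. poly q (complex_of_real (ln x))) (- \<eta>)" "\<eta> > 0"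
  shows "q = 0"
proof -
  let ?l = "\<lambda>x. complex_of_real (ln x)"
  have lim: "((\<lambda>x. poly q (?l x)) \<longlongrightarrow> 0) at_top"
  proof -
    have "((\<lambda>x::real. x powr - \<eta>) \<longlongrightarrow> 0) at_top"
      using assms(2) by real_asymp
    then have "((\<lambda>x::real. norm (complex_of_real (x powr - \<eta>))) \<longlongrightarrow> 0) at_top"
      by simp
    from tendsto_mult_right_zero[OF this]
    have *: "((\<lambda>x. c * norm (complex_of_real (x powr - \<eta>))) \<longlongrightarrow> 0) at_top" for c
      .
    obtain c where "\<forall>\<^sub>F x in at_top. norm (poly q (?l x)) \<le> c * norm (complex_of_real (x powr - \<eta>))"
      using assms(1) by (elim landau_o.bigE)
    from Lim_null_comparison[OF this *] show ?thesis .
  qed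
  have inf: "filterlim ?l at_infinity at_top"
    by (rule filterlim_compose[OF filterlim_of_real_at_infinity ln_at_top])
  \<comment> \<open>This quotient tends to the leading coefficient. Its numerator tends to 0 and its
    denominator eventually has norm at least 1, so it also tends to 0.\<close>
  have "((\<lambda>x. poly q (?l x) / ?l x ^ degree q) \<longlongrightarrow> lead_coeff q) at_top"
    by (rule filterlim_compose[OF poly_divide_tendsto_aux inf])
  moreover have "((\<lambda>x. poly q (?l x) / ?l x ^ degree q) \<longlongrightarrow> 0) at_top"
  proof (rule Lim_null_comparison[OF _ tendsto_norm_zero[OF lim]])
    show "\<forall>\<^sub>F x in at_top. norm (poly q (?l x) / ?l x ^ degree q) \<le> norm (poly q (?l x))"
      using eventually_ge_at_top[of "exp 1"]
    proof eventually_elim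
      case (elim x)
      then have "ln x \<ge> 1"
        by (metis exp_gt_zero ln_ge_iff order_less_le_trans)
      then have *: "norm (?l x ^ degree q) \<ge> 1"
        by (simp add: norm_power)
      have div: "a / b \<le> a" if "a \<ge> 0" "b \<ge> 1" for a b :: real
        using that mult_left_mono[of 1 b a] by (simp add: divide_le_eq)
      show ?case
        unfolding norm_divide by (rule div) (simp, fact *)
    qed
  qed
  ultimately have "lead_coeff q = 0"
    by (intro tendsto_unique[of at_top]) auto
  then show ?thesis by simp
qed

text \<open>A translation of the variable keeps the leading coefficient, so 1 is its only
  eigenvalue.\<close>

lemma pcompose_shift_eq_smult_imp_0:
  fixes q :: "complex poly"
  assumes "pcompose q [:h, 1:] = smult c q" "c \<noteq> 1"
  shows "q = 0"
proof -
  have "lead_coeff q = c * lead_coeff q"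
    using lead_coeff_comp[of "[:h, 1:]" q] by (auto simp: assms(1) split: if_splits)
  then show ?thesis using assms(2) by simp
qed

text \<open>The leading terms cancel. The first disjunct covers constant \<open>p\<close>, where the
  degree cannot drop.\<close>

lemma pcompose_shift_diff_less:
  fixes p :: "complex poly"
  shows "pcompose p [:h, 1:] - p = 0 \<or> degree (pcompose p [:h, 1:] - p) < degree p"
proof (rule eq_zero_or_degree_less)
  show "degree (pcompose p [:h, 1:] - p) \<le> degree p"
    by (intro degree_diff_le) (simp_all add: degree_pcompose)
  show "coeff (pcompose p [:h, 1:] - p) (degree p) = 0"
    using lead_coeff_comp[of "[:h, 1:]" p] by (simp add: degree_pcompose)
qed

text \<open>For \<open>c = exp (1 / norm r)\<close> the power is \<open>exp z\<close> with
  \<open>norm z = 1\<close>, whereas \<open>exp z = 1\<close> holds only for integer multiples of 2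
  pi i, none of which has norm 1.\<close>

lemma ex_cpow_neq_1:
  assumes "r \<noteq> 0"
  obtains c where "c > 0" "cpow c r \<noteq> 1"
proof -
  define z where "z = r / complex_of_real (norm r)"
  have z: "norm z = 1"
    using assms by (simp add: z_def norm_divide)
  have "exp z \<noteq> 1"
  proof
    assume "exp z = 1"
    then obtain n :: int where "Re z = 0" "Im z = of_int (2 * n) * pi"
      by (auto simp: exp_eq_1)
    moreover from this have "\<bar>Im z\<bar> = 1"
      using z by (simp add: cmod_def)
    ultimately have "2 * pi * \<bar>real_of_int n\<bar> = 1"
      by (simp add: abs_mult mult_ac)
    moreover have "n = 0 \<or> \<bar>real_of_int n\<bar> \<ge> 1"
      by linarith
    moreover have "2 * pi * 1 \<le> 2 * pi * \<bar>real_of_int n\<bar>" if "\<bar>real_of_int n\<bar> \<ge> 1"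
      using that by (intro mult_left_mono) auto
    ultimately show False
      using pi_gt3 by auto
  qed
  moreover have "cpow (exp (1 / norm r)) r = exp z"
    by (simp add: powr_def z_def Ln_of_real del: exp_of_real)
  ultimately show ?thesis
    using that[of "exp (1 / norm r)"] by simp
qed

definition lp_diff :: "real \<Rightarrow> complex \<Rightarrow> logpoly \<Rightarrow> logpoly" where
  "lp_diff c r xs = map (\<lambda>(s, p). (s, smult (cpow c s) (pcompose p [:complex_of_real (ln c), 1:]) - smult (cpow c r) p)) xs"

lemma lp_lp_diff:
  assumes "c > 0" "x > 0"
  shows "lp (lp_diff c r xs) x = lp xs (c * x) - cpow c r * lp xs x"
  using assms by (induction xs) (auto simp: lp_diff_def poly_pcompose ln_mult powr_times_real algebra_simps)

text \<open>The operator \<open>g \<mapsto> (\<lambda>x. g (c * x) - c^r * g x)\<close> preserves the decay and lowers the degree of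
  the polynomial at exponent \<open>r\<close>; if \<open>c^r \<noteq> 1\<close>, it is injective on the part with exponent \<open>0\<close>.
  Iterating it removes all other exponents, including the oscillating ones with real part \<open>0\<close>.\<close>

lemma lp_bigo_imp_0:
  assumes "\<eta> > 0" "0 \<notin> set (map fst xs)"
    and "bigo_pow (\<lambda>x. poly q (complex_of_real (ln x)) + lp xs x) (- \<eta>)"
  shows "q = 0"
  using assms(2,3)
\<comment> \<open>The outer induction runs over the exponents alone, because \<open>lp_diff\<close>
  changes polynomials but no exponents.\<close>
proof (induction "map fst xs" arbitrary: xs q)
  case Nil
  then show ?case
    using poly_ln_bigo_imp_0[OF _ assms(1), of q] by simp
next
  case (Cons r ss)
  from Cons.hyps(2) obtain p ys where xs: "xs = (r, p) # ys" and ss: "ss = map fst ys"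
    by (cases xs) auto
  have r: "r \<noteq> 0" and ss0: "0 \<notin> set ss"
    using Cons.prems(1) by (auto simp: xs ss)
  define n where "n = (if p = 0 then 0 else Suc (degree p))"
  have "bigo_pow (\<lambda>x. poly q (complex_of_real (ln x)) + lp ((r, p) # ys) x) (- \<eta>)"
    using Cons.prems(2) by (simp only: xs)
  then show ?case
    using n_def ss
  proof (induction n arbitrary: p ys q rule: less_induct)
    case (less n)
    note big = less.prems(1) and n = less.prems(2) and ss' = less.prems(3)
    show ?case
    proof (cases "p = 0")
      case True
      then show ?thesis
        using Cons.hyps(1)[OF ss'] ss0 big unfolding ss' by simp
    next
      case False
      obtain c where c: "c > 0" "cpow c r \<noteq> 1"
        using ex_cpow_neq_1[OF r] .
      let ?h = "complex_of_real (ln c)"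
      define q' where "q' = pcompose q [:?h, 1:] - smult (cpow c r) q"
      define p' where "p' = smult (cpow c r) (pcompose p [:?h, 1:] - p)"
      have diff: "lp_diff c r ((r, p) # ys) = (r, p') # lp_diff c r ys"
        by (simp add: lp_diff_def p'_def smult_diff_right)
      have "bigo_pow (\<lambda>x. (poly q (complex_of_real (ln (c * x))) + lp ((r, p) # ys) (c * x)) -
              cpow c r * (poly q (complex_of_real (ln x)) + lp ((r, p) # ys) x)) (- \<eta>)"
        using bigo_pow_scale[OF c(1) big] big by (intro sum_in_bigo(2)) auto
      then have "bigo_pow (\<lambda>x. poly q' (complex_of_real (ln x)) + lp (lp_diff c r ((r, p) # ys)) x) (- \<eta>)"
        by (rule landau_o.big.in_cong[THEN iffD2, rotated])
           (use eventually_gt_at_top[of 0] in eventually_elim,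
            use c(1) in \<open>simp add: lp_lp_diff q'_def poly_pcompose ln_mult algebra_simps del: lp_Cons\<close>)
      then have "bigo_pow (\<lambda>x. poly q' (complex_of_real (ln x)) + lp ((r, p') # lp_diff c r ys) x) (- \<eta>)"
        by (simp only: diff)
      moreover have "(if p' = 0 then 0 else Suc (degree p')) < n"
        using pcompose_shift_diff_less[of p ?h] False by (auto simp: n p'_def)
      moreover have "ss = map fst (lp_diff c r ys)"
        unfolding ss' by (induction ys) (auto simp: lp_diff_def)
      ultimately have "q' = 0"
        using less.IH by blast
      then have "pcompose q [:?h, 1:] = smult (cpow c r) q"
        by (simp only: q'_def right_minus_eq)
      then show ?thesis
        using c(2) by (rule pcompose_shift_eq_smult_imp_0)
    qed
  qed
qed

text \<open>In the difference of the two expansions, the entries with exponent 0 are collected into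
  one polynomial, which vanishes by \<open>lp_bigo_imp_0\<close>. This makes regularized limits well
  defined.\<close>

lemma expn_zero_part_unique:
  assumes "expn g xs \<eta>" "expn g ys \<eta>'" "\<eta> > 0" "\<eta>' > 0"
  shows "zero_part xs = zero_part ys"
proof -
  define e where "e = min \<eta> \<eta>'"
  have e: "e > 0" "expn g xs e" "expn g ys e"
    using assms by (auto simp: e_def intro: expn_mono)
  define zs where "zs = xs @ lp_mult (-1) 0 ys"
  have "bigo_pow (\<lambda>x. (g x - lp ys x) - (g x - lp xs x)) (- e)"
    by (rule sum_in_bigo(2)[OF e(3)[unfolded expn_def] e(2)[unfolded expn_def]])
  then have "bigo_pow (\<lambda>x. poly (zero_part zs) (complex_of_real (ln x)) + lp (filter (\<lambda>(s, p). s \<noteq> 0) zs) x) (- e)"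
    by (rule landau_o.big.in_cong[THEN iffD2, rotated])
       (use eventually_gt_at_top[of 0] in eventually_elim,
         simp add: lp_split_zero[symmetric], simp add: zs_def lp_lp_mult)
  then have "zero_part zs = 0"
    by (rule lp_bigo_imp_0[OF e(1), rotated]) auto
  then show ?thesis
    by (simp add: zs_def zero_part_lp_mult)
qed

section \<open>Passage between \<open>has_log_expansion\<close> and \<open>expn\<close>\<close>

definition coeff_poly :: "nat \<Rightarrow> (nat \<Rightarrow> complex) \<Rightarrow> complex poly" where
  "coeff_poly m a = (\<Sum>k\<le>m. monom (a k) k)"

lemma poly_coeff_poly: "poly (coeff_poly m a) x = (\<Sum>k\<le>m. a k * x ^ k)"
  by (simp add: coeff_poly_def poly_sum poly_monom)

lemma poly_coeff_poly_0: "poly (coeff_poly m a) 0 = a 0"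
  by (simp add: poly_coeff_poly power_0_left if_distrib cong: if_cong)

text \<open>The strict inequality for \<open>\<eta>\<close> leaves room for the logarithms in the
  error term. The head entry is the only one with exponent 0, so its polynomial is the zero
  part.\<close>

lemma has_log_expansion_imp_expn:
  assumes "has_log_expansion at_top g N \<alpha> M a" "\<eta> < - Re (\<alpha> N)"
  obtains xs where "expn g ((0, coeff_poly (M 0) (a 0)) # xs) \<eta>" "0 \<notin> set (map fst xs)"
proof -
  define xs where "xs = map (\<lambda>j. (\<alpha> j, coeff_poly (M j) (a j))) [1..<N]"
  have N: "N \<ge> 1" and nz: "\<And>j. j \<in> {1..N} \<Longrightarrow> \<alpha> j \<noteq> 0"
    and small: "(\<lambda>x. g x -
        ((\<Sum>j=1..N-1. \<Sum>k\<le>M j. a j k * cpow x (\<alpha> j) * complex_of_real (ln x) ^ k)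
         + (\<Sum>k\<le>M 0. a 0 k * complex_of_real (ln x) ^ k)))
     \<in> o[at_top](\<lambda>x. cpow x (\<alpha> N) * complex_of_real (ln x) ^ M N)"
    using assms(1) unfolding has_log_expansion_def by auto
  have "{1..N - 1} = {1..<N}"
    using N by auto
  then have lp_xs: "lp xs x = (\<Sum>j=1..N-1. \<Sum>k\<le>M j. a j k * cpow x (\<alpha> j) * complex_of_real (ln x) ^ k)" for x
    by (simp add: lp_def xs_def o_def interv_sum_list_conv_sum_set_nat poly_coeff_poly sum_distrib_left mult_ac)
  have "(\<lambda>x. cpow x (\<alpha> N) * complex_of_real (ln x) ^ M N) \<in> o[at_top](\<lambda>x. complex_of_real (x powr - \<eta>))"
    using cpow_poly_ln_smallo[of "\<alpha> N" "- \<eta>" "monom 1 (M N)"] assms(2) by (simp add: poly_monom)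
  from landau_o.small_imp_big[OF landau_o.small_trans[OF small this]]
  have "expn g ((0, coeff_poly (M 0) (a 0)) # xs) \<eta>"
    unfolding expn_def
    by (rule landau_o.big.in_cong[THEN iffD2, rotated])
       (use eventually_gt_at_top[of 0] in eventually_elim, simp add: lp_xs poly_coeff_poly)
  moreover have "0 \<notin> set (map fst xs)"
    using nz by (auto simp: xs_def)
  ultimately show ?thesis ..
qed

lemma has_LIM_at_top_imp_expn:
  assumes "has_LIM_at_top g L"
  obtains xs \<eta> where "\<eta> > 0" "expn g xs \<eta>" "L = poly (zero_part xs) 0"
proof -
  from assms obtain N \<alpha> M a where *: "has_log_expansion at_top g N \<alpha> M a" "Re (\<alpha> N) < 0" "L = a 0 0"
    unfolding has_LIM_at_top_def by blast
  define \<eta> where "\<eta> = - Re (\<alpha> N) / 2"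
  have \<eta>: "\<eta> < - Re (\<alpha> N)" "\<eta> > 0"
    using *(2) by (auto simp: \<eta>_def)
  obtain xs where xs: "expn g ((0, coeff_poly (M 0) (a 0)) # xs) \<eta>" "0 \<notin> set (map fst xs)"
    using has_log_expansion_imp_expn[OF *(1) \<eta>(1)] .
  have "zero_part xs = 0"
    using xs(2) by (induction xs) auto
  then show ?thesis
    using that[OF \<eta>(2) xs(1)] *(3) by (simp add: poly_coeff_poly_0)
qed

text \<open>Half of the decay rate serves as cut-off: entries with real part at least
  \<open>- \<eta> / 2\<close> are kept and sorted, while the remaining ones and the error are of
  smaller order than the power with exponent \<open>- \<eta> / 2\<close>, which becomes the last
  exponent.\<close>

lemma expn_imp_has_LIM_at_top:
  assumes "expn g xs \<eta>" "\<eta> > 0"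
  shows "has_LIM_at_top g (poly (zero_part xs) 0)"
proof -
  define P where "P = (\<lambda>y :: complex \<times> complex poly. - \<eta> / 2 \<le> Re (fst y))"
  define xs' where "xs' = filter (\<lambda>(s, p). s \<noteq> 0) xs"
  define ls where "ls = sort_key (\<lambda>y. - Re (fst y)) (filter P xs')"
  define n where "n = length ls"
  \<comment> \<open>The list \<open>ls\<close> is indexed from 0, the exponents from 1; index 0 of
    \<open>ps\<close> holds the zero part. Beyond \<open>n\<close> the polynomial is 0, so that
    \<open>M (Suc n) = 0\<close> and the error bound carries no logarithm.\<close>
  define \<alpha> where "\<alpha> = (\<lambda>j. if j \<le> n then fst (ls ! (j - 1)) else complex_of_real (- \<eta> / 2))"
  define ps where "ps = (\<lambda>j. if j = 0 then zero_part xs else if j \<le> n then snd (ls ! (j - 1)) else 0)"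
  define M where "M = (\<lambda>j. degree (ps j))"
  define a where "a = (\<lambda>j k. coeff (ps j) k)"
  have ls: "s \<noteq> 0" "- \<eta> / 2 \<le> Re s" if "(s, p) \<in> set ls" for s p
    using that by (auto simp: ls_def xs'_def P_def)
  have nth: "ls ! (j - 1) \<in> set ls" if "j \<in> {1..n}" for j
    using that by (auto simp: n_def)
  have "lp ls x = (\<Sum>j=1..n. cpow x (\<alpha> j) * poly (ps j) (complex_of_real (ln x)))" for x
  proof -
    have "lp ls x = (\<Sum>i<n. case ls ! i of (s, p) \<Rightarrow> cpow x s * poly p (complex_of_real (ln x)))"
      by (simp add: lp_def sum_list_sum_nth n_def atLeast0LessThan)
    also have "\<dots> = (\<Sum>j=1..n. cpow x (\<alpha> j) * poly (ps j) (complex_of_real (ln x)))"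
      by (rule sum.reindex_bij_witness[of _ "\<lambda>j. j - 1" Suc])
         (auto simp: \<alpha>_def ps_def case_prod_unfold)
    finally show ?thesis .
  qed
  then have lp_ls: "lp ls x = (\<Sum>j=1..n. \<Sum>k\<le>M j. a j k * cpow x (\<alpha> j) * complex_of_real (ln x) ^ k)" for x
    by (simp add: M_def a_def poly_altdef sum_distrib_left mult_ac)
  \<comment> \<open>Sorting only permutes the entries, so both sides are the same sum over a
    multiset.\<close>
  have "lp ls x = lp (filter P xs') x" for x
    unfolding lp_def sum_mset_sum_list[symmetric] ls_def mset_map mset_sort ..
  then have lp_xs: "lp xs x = poly (zero_part xs) (complex_of_real (ln x)) + lp ls x + lp (filter (\<lambda>y. \<not> P y) xs') x"
    if "x > 0" for x
    using lp_split_zero[OF that, of xs] lp_partition[of xs' x P] by (simp add: xs'_def)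
  have "lp (filter (\<lambda>y. \<not> P y) xs') \<in> o[at_top](\<lambda>x. complex_of_real (x powr (- \<eta> / 2)))"
    by (rule lp_smallo) (auto simp: P_def)
  moreover have "(\<lambda>x. g x - lp xs x) \<in> o[at_top](\<lambda>x. complex_of_real (x powr (- \<eta> / 2)))"
    by (rule landau_o.big_small_trans[OF assms(1)[unfolded expn_def] powr_smallo_powr]) (use assms(2) in simp)
  ultimately have "(\<lambda>x. (g x - lp xs x) + lp (filter (\<lambda>y. \<not> P y) xs') x)
      \<in> o[at_top](\<lambda>x. complex_of_real (x powr (- \<eta> / 2)))"
    by (intro sum_in_smallo(1))
  then have "(\<lambda>x. g x - (lp ls x + poly (zero_part xs) (complex_of_real (ln x))))
      \<in> o[at_top](\<lambda>x. cpow x (\<alpha> (Suc n)) * complex_of_real (ln x) ^ M (Suc n))"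
    by (rule landau_o.small.cong_ex[THEN iffD2, rotated 2])
       (use eventually_gt_at_top[of 0] in eventually_elim,
         simp add: lp_xs \<alpha>_def M_def ps_def powr_of_real del: of_real_divide of_real_minus)+
  moreover have "poly (zero_part xs) x = (\<Sum>k\<le>M 0. a 0 k * x ^ k)" for x
    by (simp add: M_def a_def ps_def poly_altdef)
  moreover have "\<alpha> j \<noteq> 0" if "j \<in> {1..Suc n}" for j
    using that ls(1)[of "fst (ls ! (j - 1))" "snd (ls ! (j - 1))"] nth[of j] assms(2)
    by (cases "j = Suc n") (auto simp: \<alpha>_def)
  ultimately have "has_log_expansion at_top g (Suc n) \<alpha> M a"
    unfolding has_log_expansion_def by (simp add: lp_ls)
  moreover have "antimono_on {1..Suc n} (\<lambda>j. Re (\<alpha> j))"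
  proof (rule monotone_onI)
    fix i j assume ij: "i \<in> {1..Suc n}" "j \<in> {1..Suc n}" "i \<le> j"
    show "Re (\<alpha> j) \<le> Re (\<alpha> i)"
    proof (cases "j = Suc n")
      case True
      then show ?thesis
        using ij nth[of i] ls(2)[of "fst (ls ! (i - 1))" "snd (ls ! (i - 1))"] by (cases "i = Suc n") (auto simp: \<alpha>_def)
    next
      case False
      have "sorted (map (\<lambda>y. - Re (fst y)) ls)"
        by (simp add: ls_def)
      then have "map (\<lambda>y. - Re (fst y)) ls ! (i - 1) \<le> map (\<lambda>y. - Re (fst y)) ls ! (j - 1)"
        using ij False by (intro sorted_nth_mono) (auto simp: n_def)
      then show ?thesis
        using ij False by (simp add: \<alpha>_def n_def)
    qed
  qed
  moreover have "Re (\<alpha> (Suc n)) < 0" "poly (zero_part xs) 0 = a 0 0"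
    using assms(2) by (simp_all add: \<alpha>_def a_def ps_def poly_0_coeff_0)
  ultimately show ?thesis
    unfolding has_LIM_at_top_def by blast
qed

lemma has_LIM_at_top_unique:
  assumes "has_LIM_at_top g L" "has_LIM_at_top g L'"
  shows "L = L'"
proof -
  obtain xs \<eta> where "\<eta> > 0" "expn g xs \<eta>" "L = poly (zero_part xs) 0"
    using has_LIM_at_top_imp_expn[OF assms(1)] .
  moreover obtain ys \<eta>' where "\<eta>' > 0" "expn g ys \<eta>'" "L' = poly (zero_part ys) 0"
    using has_LIM_at_top_imp_expn[OF assms(2)] .
  ultimately show ?thesis
    using expn_zero_part_unique[of g xs \<eta> ys \<eta>'] by simp
qed

lemma LIM_at_top_eqI: "has_LIM_at_top g L \<Longrightarrow> LIM_at_top g = L"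
  unfolding LIM_at_top_def using has_LIM_at_top_unique by blast

section \<open>Termwise integration of expansions\<close>

lemma ex_poly_ode:
  fixes p :: "complex poly"
  shows "\<exists>q. smult c q + pderiv q = p"
proof (cases "c = 0")
  case True
  define q where "q = (\<Sum>k\<le>degree p. monom (coeff p k / of_nat (Suc k)) (Suc k))"
  have "pderiv q = (\<Sum>k\<le>degree p. monom (coeff p k) k)"
  proof -
    have "pderiv (sum f A) = (\<Sum>k\<in>A. pderiv (f k))" for f :: "nat \<Rightarrow> complex poly" and A
      by (induction A rule: infinite_finite_induct) (auto simp: pderiv_add)
    then show ?thesis
      by (simp add: q_def pderiv_monom del: of_nat_Suc)
  qed
  then show ?thesis
    using True by (intro exI[of _ q]) (simp add: poly_as_sum_of_monoms)
next
  case False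
  show ?thesis
  proof (induction "degree p" arbitrary: p rule: less_induct)
    case less
    show ?case
    proof (cases "degree p = 0")
      case True
      then obtain a where "p = [:a:]"
        by (elim degree_eq_zeroE)
      then show ?thesis
        using False by (intro exI[of _ "[:a / c:]"]) simp
    next
      case deg: False
      then have "degree (pderiv p) < degree p"
        by (simp add: degree_pderiv)
      \<comment> \<open>A solution \<open>q\<close> for \<open>pderiv p\<close> yields the solution
        \<open>(p - q) / c\<close> for \<open>p\<close>, whose derivative is
        \<open>(pderiv p - pderiv q) / c = q\<close>.\<close>
      then obtain q where q: "smult c q + pderiv q = pderiv p"
        using less by blast
      have "smult c (smult (1 / c) (p - q)) + pderiv (smult (1 / c) (p - q))
          = p - q + smult (1 / c) (pderiv p - pderiv q)"
        using False by (simp add: pderiv_smult pderiv_diff)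
      also have "pderiv p - pderiv q = smult c q"
        by (simp flip: q)
      finally have "smult c (smult (1 / c) (p - q)) + pderiv (smult (1 / c) (p - q)) = p"
        using False by simp
      then show ?thesis ..
    qed
  qed
qed

text \<open>\<open>x^c * q (ln x)\<close> has the derivative \<open>x^(c - 1) * (c * q + q') (ln x)\<close>, so this polynomial
  gives a primitive of \<open>x^(c - 1) * p (ln x)\<close>.\<close>

definition poly_ode :: "complex \<Rightarrow> complex poly \<Rightarrow> complex poly" where
  "poly_ode c p = (SOME q. smult c q + pderiv q = p)"

lemma poly_ode: "smult c (poly_ode c p) + pderiv (poly_ode c p) = p"
  unfolding poly_ode_def by (rule someI_ex[OF ex_poly_ode])

lemma has_vector_derivative_cpow_poly_ln:
  assumes "x > 0"
  shows "((\<lambda>x. cpow x (s + 1) * poly q (complex_of_real (ln x))) has_vector_derivative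
           cpow x s * poly (smult (s + 1) q + pderiv q) (complex_of_real (ln x))) (at x)"
proof -
  \<comment> \<open>The product is differentiated in the complex plane off the branch cut and then
    restricted to the positive reals, where \<open>Ln\<close> and \<open>ln\<close> agree.\<close>
  let ?f = "\<lambda>z. z powr (s + 1) * poly q (Ln z)"
  have nz: "complex_of_real x \<notin> \<real>\<^sub>\<le>\<^sub>0"
    using assms by simp
  have d: "(?f has_field_derivative
      complex_of_real x powr s * poly (smult (s + 1) q + pderiv q) (Ln (complex_of_real x))) (at (complex_of_real x))"
    using DERIV_mult[OF has_field_derivative_powr[OF nz, of "s + 1"]
        DERIV_chain2[OF poly_DERIV has_field_derivative_Ln[OF nz], of q]] assms
    by (simp add: field_simps powr_add)
  have "((\<lambda>x. ?f (complex_of_real x)) has_vector_derivative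
      complex_of_real x powr s * poly (smult (s + 1) q + pderiv q) (Ln (complex_of_real x))) (at x)"
    by (rule has_vector_derivative_real_field[OF d])
  then have "((\<lambda>x. ?f (complex_of_real x)) has_vector_derivative
      cpow x s * poly (smult (s + 1) q + pderiv q) (complex_of_real (ln x))) (at x)"
    using assms by (simp add: Ln_of_real)
  then show ?thesis
    by (rule has_vector_derivative_transform_within_open[of _ _ _ "{0<..}"])
       (use assms in \<open>auto simp: Ln_of_real\<close>)
qed

definition lp_prim :: "logpoly \<Rightarrow> logpoly" where
  "lp_prim xs = map (\<lambda>(s, p). (s + 1, poly_ode (s + 1) p)) xs"

lemma has_vector_derivative_lp_prim:
  assumes "x > 0"
  shows "(lp (lp_prim xs) has_vector_derivative lp xs x) (at x)"
proof (induction xs)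
  case Nil
  then show ?case by (simp add: lp_prim_def lp_def[abs_def])
next
  case (Cons y xs)
  obtain s p where y: "y = (s, p)" by (cases y)
  have "((\<lambda>x. cpow x (s + 1) * poly (poly_ode (s + 1) p) (complex_of_real (ln x)) + lp (lp_prim xs) x)
      has_vector_derivative (cpow x s * poly p (complex_of_real (ln x)) + lp xs x)) (at x)"
    using has_vector_derivative_cpow_poly_ln[OF assms, of s "poly_ode (s + 1) p"] Cons.IH
    unfolding poly_ode by (rule has_vector_derivative_add)
  moreover have "lp (lp_prim (y # xs)) = (\<lambda>x. cpow x (s + 1) * poly (poly_ode (s + 1) p) (complex_of_real (ln x)) + lp (lp_prim xs) x)"
    by (auto simp: y lp_prim_def)
  ultimately show ?case by (simp add: y)
qed

text \<open>Beyond the given expansion, integration only produces a constant: the derivative of the error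
  term is integrable at infinity.\<close>

lemma expn_antiderivative:
  assumes deriv: "\<And>x. x > 0 \<Longrightarrow> (F has_vector_derivative u x) (at x)"
    and u: "expn u xs \<eta>" and \<eta>: "\<eta> > 1"
  obtains C where "expn F ((0, [:C:]) # lp_prim xs) (\<eta> - 1)"
proof -
  define \<Phi> where "\<Phi> = (\<lambda>x. F x - lp (lp_prim xs) x)"
  have d\<Phi>: "(\<Phi> has_vector_derivative (u x - lp xs x)) (at x)" if "x > 0" for x
    unfolding \<Phi>_def by (intro has_vector_derivative_diff deriv has_vector_derivative_lp_prim that)
  obtain K where K: "K > 0" "\<forall>\<^sub>F x in at_top. norm (u x - lp xs x) \<le> K * norm (complex_of_real (x powr - \<eta>))"
    using u unfolding expn_def by (elim landau_o.bigE)
  then obtain X0 where X0: "norm (u x - lp xs x) \<le> K * x powr - \<eta>" if "x \<ge> X0" for x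
    by (auto simp: eventually_at_top_linorder)
  define X where "X = max X0 1"
  \<comment> \<open>With this constant, \<open>\<phi>\<close> is the primitive of the majorant
    \<open>K * x powr - \<eta>\<close> that vanishes at infinity. It is negative for positive
    \<open>x\<close>, so its increments from \<open>x\<close> on are at most
    \<open>- \<phi> x\<close>.\<close>
  define K' where "K' = K / (\<eta> - 1)"
  define \<phi> where "\<phi> = (\<lambda>x. - K' * x powr (1 - \<eta>))"
  have K': "K' > 0"
    using K \<eta> by (simp add: K'_def)
  have d\<phi>: "(\<phi> has_real_derivative K * x powr - \<eta>) (at x)" if "x > 0" for x
  proof -
    have "- K' * ((1 - \<eta>) * x powr (1 - \<eta> - 1)) = K * x powr - \<eta>"
      using \<eta> by (simp add: K'_def field_simps)
    then show ?thesis
      using DERIV_cmult[OF has_real_derivative_powr[OF that, of "1 - \<eta>"], of "- K'"]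
      by (simp only: \<phi>_def)
  qed
  have bound: "norm (\<Phi> y - \<Phi> x) \<le> K' * x powr (1 - \<eta>)" if "X \<le> x" "x \<le> y" for x y
  proof (cases "x = y")
    case True
    then show ?thesis using K' by simp
  next
    case False
    have pos: "x > 0" and y: "x < y" "x \<ge> X0"
      using that False by (auto simp: X_def)
    have "norm (\<Phi> y - \<Phi> x) \<le> \<phi> y - \<phi> x"
    proof (rule differentiable_bound_general[OF y(1)])
      show "continuous_on {x..y} \<Phi>"
        using pos by (intro continuous_on_vector_derivative[OF has_vector_derivative_at_within[OF d\<Phi>]]) auto
      show "continuous_on {x..y} \<phi>"
        using pos by (intro DERIV_continuous_on[OF has_field_derivative_at_within[OF d\<phi>]]) auto
    qed (use pos y X0 in \<open>auto intro: d\<Phi> d\<phi> simp flip: has_real_derivative_iff_has_vector_derivative\<close>)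
    also have "\<dots> \<le> - \<phi> x"
      using K' by (simp add: \<phi>_def)
    finally show ?thesis by (simp add: \<phi>_def)
  qed
  have lim0: "((\<lambda>x::real. K' * x powr (1 - \<eta>)) \<longlongrightarrow> 0) at_top"
    using \<eta> by real_asymp
  \<comment> \<open>The limit is taken along the integers to use completeness for sequences; letting
    the upper endpoint in \<open>bound\<close> run through them gives the rate for all real
    \<open>x \<ge> X\<close>.\<close>
  have "Cauchy (\<lambda>n. \<Phi> (real n))"
  proof (rule metric_CauchyI)
    fix e :: real assume "e > 0"
    from order_tendstoD(2)[OF lim0 this] eventually_ge_at_top[of X]
    have "\<forall>\<^sub>F x in at_top. X \<le> x \<and> K' * x powr (1 - \<eta>) < e"
      by eventually_elim auto
    then obtain B where B: "\<And>x. x \<ge> B \<Longrightarrow> X \<le> x \<and> K' * x powr (1 - \<eta>) < e"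
      by (auto simp: eventually_at_top_linorder)
    define n0 where "n0 = nat \<lceil>B\<rceil>"
    have *: "norm (\<Phi> (real n) - \<Phi> (real m)) < e" if "n0 \<le> m" "m \<le> n" for m n
    proof -
      have "B \<le> real m"
        using that(1) by (simp add: n0_def)
      then show ?thesis
        using bound[of "real m" "real n"] B[of "real m"] that(2) by simp
    qed
    show "\<exists>M. \<forall>m\<ge>M. \<forall>n\<ge>M. dist (\<Phi> (real m)) (\<Phi> (real n)) < e"
      using * by (metis dist_norm norm_minus_commute nat_le_linear)
  qed
  then obtain C where C: "(\<lambda>n. \<Phi> (real n)) \<longlonglongrightarrow> C"
    by (auto simp: Cauchy_convergent_iff convergent_def)
  have "norm (\<Phi> x - C) \<le> K' * x powr (1 - \<eta>)" if "X \<le> x" for x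
  proof (rule tendsto_upperbound)
    show "(\<lambda>n. norm (\<Phi> x - \<Phi> (real n))) \<longlonglongrightarrow> norm (\<Phi> x - C)"
      by (intro tendsto_intros C)
    have "\<forall>\<^sub>F n in sequentially. x \<le> real n"
      using filterlim_real_sequentially by (auto simp: filterlim_at_top)
    then show "\<forall>\<^sub>F n in sequentially. norm (\<Phi> x - \<Phi> (real n)) \<le> K' * x powr (1 - \<eta>)"
      by eventually_elim (use bound[OF that] norm_minus_commute in metis)
  qed simp
  then have "bigo_pow (\<lambda>x. \<Phi> x - C) (1 - \<eta>)"
    by (intro bigoI[of _ K'] eventually_at_top_linorderI[of X]) simp
  then have "expn F ((0, [:C:]) # lp_prim xs) (\<eta> - 1)"
    unfolding expn_def minus_diff_eq
    by (rule landau_o.big.in_cong[THEN iffD2, rotated])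
       (use eventually_gt_at_top[of 0] in eventually_elim, simp add: \<Phi>_def)
  then show ?thesis ..
qed

section \<open>Regularized limits at 0 by inversion\<close>

lemma has_log_expansion_inverse_iff:
  "has_log_expansion (at_right 0) (\<lambda>x. g (1 / x)) N (\<lambda>j. - \<alpha> j) M (\<lambda>j k. (-1) ^ k * a j k)
     \<longleftrightarrow> has_log_expansion at_top g N \<alpha> M a"
proof -
  let ?E = "\<lambda>x. g x -
        ((\<Sum>j=1..N-1. \<Sum>k\<le>M j. a j k * cpow x (\<alpha> j) * complex_of_real (ln x) ^ k)
         + (\<Sum>k\<le>M 0. a 0 k * complex_of_real (ln x) ^ k))"
  let ?E' = "\<lambda>x. g (1 / x) -
        ((\<Sum>j=1..N-1. \<Sum>k\<le>M j. (-1) ^ k * a j k * cpow x (- \<alpha> j) * complex_of_real (ln x) ^ k)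
         + (\<Sum>k\<le>M 0. (-1) ^ k * a 0 k * complex_of_real (ln x) ^ k))"
  let ?w = "\<lambda>x. cpow x (\<alpha> N) * complex_of_real (ln x) ^ M N"
  let ?w' = "\<lambda>x. cpow x (- \<alpha> N) * complex_of_real (ln x) ^ M N"
  \<comment> \<open>Inversion negates exponents and logarithms, so \<open>(ln x) ^ k\<close> picks
    up the sign \<open>(-1) ^ k\<close>. In the error bound this sign is a non-zero constant factor
    and drops out.\<close>
  have pow: "cpow (inverse x) s = cpow x (- s)" "ln (inverse x) = - ln x" if "x > 0" for x s
    using that by (simp_all add: powr_def ln_inverse Ln_of_real flip: of_real_inverse)
  have "?E \<in> o[at_top](?w) \<longleftrightarrow> (\<lambda>x. ?E (inverse x)) \<in> o[at_right 0](\<lambda>x. ?w (inverse x))"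
    unfolding at_top_to_right landau_o.small.in_filtermap_iff ..
  also have "\<dots> \<longleftrightarrow> ?E' \<in> o[at_right 0](\<lambda>x. (-1) ^ M N * ?w' x)"
  proof (rule landau_o.small.cong_ex)
    show "\<forall>\<^sub>F x in at_right 0. ?E (inverse x) = ?E' x"
      using eventually_at_right_less[of "0 :: real"]
    proof eventually_elim
      case (elim x)
      have "a j k * cpow (inverse x) (\<alpha> j) * complex_of_real (ln (inverse x)) ^ k
          = (-1) ^ k * a j k * cpow x (- \<alpha> j) * complex_of_real (ln x) ^ k" for j k
        using elim by (simp add: pow power_minus[of "complex_of_real _"] del: of_real_inverse)
      moreover have "a 0 k * complex_of_real (ln (inverse x)) ^ k = (-1) ^ k * a 0 k * complex_of_real (ln x) ^ k" for k
        using elim by (simp add: pow power_minus[of "complex_of_real _"] del: of_real_inverse)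
      ultimately show ?case
        by (simp only: inverse_eq_divide)
    qed
  next
    show "\<forall>\<^sub>F x in at_right 0. ?w (inverse x) = (-1) ^ M N * ?w' x"
      using eventually_at_right_less[of "0 :: real"]
      by eventually_elim (simp add: pow power_minus[of "complex_of_real _"] del: of_real_inverse)
  qed
  also have "\<dots> \<longleftrightarrow> ?E' \<in> o[at_right 0](?w')"
    by (subst landau_o.small.cmult) simp_all
  finally show ?thesis
    unfolding has_log_expansion_def by simp
qed

text \<open>The sign \<open>(-1) ^ k\<close> is 1 at \<open>k = 0\<close>, so the coefficient that
  defines the limit is unchanged, while the order of the real parts is reversed.\<close>

lemma has_LIM_at_0_inverse_iff: "has_LIM_at_0 (\<lambda>x. g (1 / x)) L \<longleftrightarrow> has_LIM_at_top g L"
proof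
  assume "has_LIM_at_top g L"
  then obtain N \<alpha> M a where *: "has_log_expansion at_top g N \<alpha> M a"
      "antimono_on {1..N} (\<lambda>j. Re (\<alpha> j))" "Re (\<alpha> N) < 0" "L = a 0 0"
    unfolding has_LIM_at_top_def by blast
  show "has_LIM_at_0 (\<lambda>x. g (1 / x)) L"
    unfolding has_LIM_at_0_def
    by (intro exI[of _ N] exI[of _ "\<lambda>j. - \<alpha> j"] exI[of _ M] exI[of _ "\<lambda>j k. (-1) ^ k * a j k"] conjI
          has_log_expansion_inverse_iff[THEN iffD2])
       (use * in \<open>auto simp: monotone_on_def\<close>)
next
  assume "has_LIM_at_0 (\<lambda>x. g (1 / x)) L"
  then obtain N \<alpha> M a where *: "has_log_expansion (at_right 0) (\<lambda>x. g (1 / x)) N \<alpha> M a"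
      "mono_on {1..N} (\<lambda>j. Re (\<alpha> j))" "Re (\<alpha> N) > 0" "L = a 0 0"
    unfolding has_LIM_at_0_def by blast
  have "(\<lambda>j k. (-1) ^ k * ((-1) ^ k * a j k)) = a"
    by (simp add: fun_eq_iff flip: mult.assoc power_mult_distrib)
  then have "has_log_expansion at_top g N (\<lambda>j. - \<alpha> j) M (\<lambda>j k. (-1) ^ k * a j k)"
    using *(1) has_log_expansion_inverse_iff[of g N "\<lambda>j. - \<alpha> j" M "\<lambda>j k. (-1) ^ k * a j k"] by simp
  then show "has_LIM_at_top g L"
    unfolding has_LIM_at_top_def
    by (intro exI[of _ N] exI[of _ "\<lambda>j. - \<alpha> j"] exI[of _ M] exI[of _ "\<lambda>j k. (-1) ^ k * a j k"])
       (use * in \<open>auto simp: monotone_on_def\<close>)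
qed

lemma LIM_at_0_eqI:
  assumes "has_LIM_at_0 g L"
  shows "LIM_at_0 g = L"
proof -
  have "has_LIM_at_top (\<lambda>x. g (1 / x)) L'" if "has_LIM_at_0 g L'" for L'
    using that has_LIM_at_0_inverse_iff[of "\<lambda>x. g (1 / x)" L'] by simp
  then show ?thesis
    unfolding LIM_at_0_def using assms has_LIM_at_top_unique by blast
qed

section \<open>Regularized integrals of homogeneous functions\<close>

lemma zero_part_eq_0: "0 \<notin> set (map fst xs) \<Longrightarrow> zero_part xs = 0"
  by (induction xs) auto

lemma expn_cmult:
  assumes "expn g xs \<eta>"
  shows "expn (\<lambda>x. c * g x) (lp_mult c 0 xs) \<eta>"
proof (rule expn_cong)
  show "expn (\<lambda>x. c * cpow x 0 * g x) (lp_mult c 0 xs) \<eta>"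
    using expn_mult[OF assms, of c 0] by simp
  show "\<forall>\<^sub>F x in at_top. c * g x = c * cpow x 0 * g x"
    using eventually_gt_at_top[of 0] by eventually_elim simp
qed

lemma integral_eq_diff:
  fixes g :: "real \<Rightarrow> complex"
  assumes "a \<le> b" "\<And>x. a \<le> x \<Longrightarrow> x \<le> b \<Longrightarrow> (G has_vector_derivative g x) (at x)"
  shows "integral {a..b} g = G b - G a"
  by (rule integral_unique, rule fundamental_theorem_of_calculus)
     (use assms in \<open>auto intro: has_vector_derivative_at_within\<close>)

text \<open>Weight and primitive shift the exponent \<open>s\<close> of an entry of
  \<open>vs\<close> to \<open>s - d - 1\<close>, and the factor \<open>n^(d + 1)\<close> shifts it
  back to \<open>s\<close>, which is non-zero. So exponent 0 arises from \<open>b\<close>, and from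
  \<open>Q\<close> and \<open>C\<close> exactly if \<open>d = -1\<close>.\<close>

lemma has_LIM_at_top_powr_antiderivative:
  assumes "expn W ((0, [:C:]) # lp_prim (lp_mult 1 (- d - 2) ((0, b) # vs))) (\<eta> + Re d + 1)"
    and "0 \<notin> set (map fst vs)" "\<eta> > 0"
  shows "has_LIM_at_top (\<lambda>n. cpow n (d + 1) * (poly Q (- complex_of_real (ln n)) + W n))
           ((if d = -1 then poly Q 0 + C else 0) + poly (poly_ode (- (d + 1)) b) 0)"
proof -
  define Ws where "Ws = (0, [:C:]) # lp_prim (lp_mult 1 (- d - 2) ((0, b) # vs))"
  have "expn (\<lambda>n. 1 * cpow n (d + 1) * W n) (lp_mult 1 (d + 1) Ws) (\<eta> + Re d + 1 - Re (d + 1))"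
    using assms(1) unfolding Ws_def by (rule expn_mult)
  then have 1: "expn (\<lambda>n. cpow n (d + 1) * W n) (lp_mult 1 (d + 1) Ws) \<eta>"
    by simp
  have 2: "expn (\<lambda>n. cpow n (d + 1) * poly Q (- complex_of_real (ln n))) [(d + 1, pcompose Q [:0, -1:])] \<eta>"
    by (rule expn_lp) (simp add: poly_pcompose)
  have vs: "zero_part (lp_mult 1 (d + 1) (lp_prim (lp_mult 1 (- d - 2) vs))) = 0"
    by (rule zero_part_eq_0) (use assms(2) in \<open>auto simp: lp_mult_def lp_prim_def image_iff\<close>)
  have exponent: "- 1 - d = - (d + 1)"
    by simp
  have "zero_part (lp_mult 1 (d + 1) Ws) = (if d = -1 then [:C:] else 0) + poly_ode (- (d + 1)) b"
    using vs by (simp add: Ws_def lp_mult_def lp_prim_def add_eq_0_iff2 exponent del: minus_add_distrib)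
  then have "poly (zero_part ([(d + 1, pcompose Q [:0, -1:])] @ lp_mult 1 (d + 1) Ws)) 0
      = (if d = -1 then poly Q 0 + C else 0) + poly (poly_ode (- (d + 1)) b) 0"
    by (simp add: add_eq_0_iff2 poly_pcompose)
  then show ?thesis
    using expn_imp_has_LIM_at_top[OF expn_add[OF 2 1] assms(3)] by (simp add: algebra_simps)
qed

theorem proposition1p3:
  fixes f :: "real \<times> real \<Rightarrow> complex" and d :: complex
    and N N' :: nat and \<alpha> \<beta> :: "nat \<Rightarrow> complex" and M M' :: "nat \<Rightarrow> nat"
    and a b :: "nat \<Rightarrow> nat \<Rightarrow> complex"
  assumes smooth: "smooth_on ({0<..} \<times> {0<..}) f"
    and homogeneous: "\<And>t z n. t > 0 \<Longrightarrow> z > 0 \<Longrightarrow> n > 0 \<Longrightarrow>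
          f (t * z, t * n) = complex_of_real t powr d * f (z, n)"
    and expansion_z: "has_log_expansion at_top (\<lambda>z. f (z, 1)) N \<alpha> M a"
    and expansion_n: "has_log_expansion at_top (\<lambda>n. f (1, n)) N' \<beta> M' b"
    and decreasing: "antimono_on {1..N} (\<lambda>j. Re (\<alpha> j))" "antimono_on {1..N'} (\<lambda>j. Re (\<beta> j))"
    and Re_\<alpha>: "Re (\<alpha> N) < -1"
    and Re_\<beta>: "Re (\<beta> N') < min 0 (Re d + 1)"
  shows "(\<forall>n>0. reg_integrable_1_inf (\<lambda>z. f (z, n))) \<and>
         LIM_exists_at_top (\<lambda>n. reg_integral_1_inf (\<lambda>z. f (z, n))) \<and>
         (\<forall>z\<ge>1. LIM_exists_at_top (\<lambda>n. f (z, n))) \<and>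
         reg_integrable_1_inf (\<lambda>z. LIM_at_top (\<lambda>n. f (z, n))) \<and>
         (d = -1 \<longrightarrow> reg_integrable_0_inf (\<lambda>z. f (z, 1))) \<and>
         LIM_at_top (\<lambda>n. reg_integral_1_inf (\<lambda>z. f (z, n))) =
           reg_integral_1_inf (\<lambda>z. LIM_at_top (\<lambda>n. f (z, n))) +
           (if d = -1 then reg_integral_0_inf (\<lambda>z. f (z, 1)) else 0)"
proof -
  define u where "u = (\<lambda>z. f (z, 1))"
  define v where "v = (\<lambda>n. f (1, n))"
  have f_u: "f (z, n) = cpow n d * u (z / n)" if "z > 0" "n > 0" for z n
    using homogeneous[of n "z / n" 1] that by (simp add: u_def)
  have f_v: "f (z, n) = cpow z d * v (n / z)" if "z > 0" "n > 0" for z n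
    using homogeneous[of z 1 "n / z"] that by (simp add: v_def)
  have "Ck_on 0 ({0<..} \<times> {0<..}) f"
    using smooth unfolding smooth_on_def ..
  then have "continuous_on ({0<..} \<times> {0<..}) f"
    by simp
  then have contf: "continuous_on {0<..} (\<lambda>z. f (z, n))" if "n > 0" for n
    by (rule continuous_on_compose2) (use that in \<open>auto intro!: continuous_intros\<close>)
  have absint: "(\<lambda>z. f (z, n)) absolutely_integrable_on {x..y}" if "n > 0" "x > 0" for n x y
    by (rule absolutely_integrable_continuous_real, rule continuous_on_subset[OF contf])
       (use that in auto)

  have "isCont u x" if "x > 0" for x
    using contf[of 1] that by (auto simp: u_def continuous_on_eq_continuous_at)
  \<comment> \<open>The additive constant in \<open>F\<close> is arbitrary: it enters
    \<open>Q\<close> and \<open>W\<close> with opposite signs and cancels in their sum.\<close>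
  then obtain F where F: "(F has_vector_derivative u x) (at x)" if "x > 0" for x
    using einterval_antiderivative[of 0 \<infinity> u] by (auto simp: zero_ereal_def)
  \<comment> \<open>Inversion moves the behaviour of \<open>F\<close> at 0, which is governed by
    \<open>f (1, n)\<close> for large \<open>n\<close>, to infinity.\<close>
  define W where "W = (\<lambda>x. - F (1 / x))"

  \<comment> \<open>The bound \<open>\<eta>1 > 1\<close> makes the error of \<open>u\<close>
    integrable at infinity.\<close>
  obtain \<eta>1 where \<eta>1: "1 < \<eta>1" "\<eta>1 < - Re (\<alpha> N)"
    using dense[of 1 "- Re (\<alpha> N)"] Re_\<alpha> by auto
  obtain us where "expn u us \<eta>1"
    using has_log_expansion_imp_expn[OF expansion_z \<eta>1(2)] unfolding u_def by blast
  from expn_antiderivative[OF F this \<eta>1(1)] obtain Fs where Fs: "expn F Fs (\<eta>1 - 1)"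
    by blast
  define Q where "Q = zero_part Fs"

  \<comment> \<open>The error of \<open>v\<close> decays since \<open>\<eta>2 > 0\<close>; the error
    of \<open>x^(-d - 2) * v x\<close>, the derivative of \<open>W\<close>, is integrable at
    infinity since \<open>\<eta>2 > - Re d - 1\<close>.\<close>
  have "max 0 (- Re d - 1) < - Re (\<beta> N')"
    using Re_\<beta> by auto
  from dense[OF this] obtain \<eta>2 where \<eta>2: "0 < \<eta>2" "- Re d - 1 < \<eta>2" "\<eta>2 < - Re (\<beta> N')"
    by auto
  define b0 where "b0 = coeff_poly (M' 0) (b 0)"
  obtain vs where vs: "expn v ((0, b0) # vs) \<eta>2" "0 \<notin> set (map fst vs)"
    using has_log_expansion_imp_expn[OF expansion_n \<eta>2(3)] unfolding v_def b0_def by blast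
  have dW: "(W has_vector_derivative (1 * cpow x (- d - 2) * v x)) (at x)" if "x > 0" for x
  proof -
    have "((\<lambda>x::real. 1 / x) has_vector_derivative (- 1 / x\<^sup>2)) (at x)"
      using that unfolding has_real_derivative_iff_has_vector_derivative[symmetric]
      by (auto intro!: derivative_eq_intros simp: power2_eq_square)
    moreover have "(F has_vector_derivative u (1 / x)) (at (1 / x))"
      using that by (intro F) simp
    ultimately have "(F \<circ> (\<lambda>x. 1 / x) has_vector_derivative (- 1 / x\<^sup>2) *\<^sub>R u (1 / x)) (at x)"
      by (rule vector_diff_chain_at)
    from has_vector_derivative_minus[OF this]
    have "(W has_vector_derivative (1 / x\<^sup>2) *\<^sub>R u (1 / x)) (at x)"
      by (simp add: W_def o_def)
    also have "u (1 / x) = cpow x (- d) * v x"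
      using f_v[of "1 / x" 1] that by (simp add: u_def powr_def ln_div Ln_of_real flip: of_real_divide)
    also have "(1 / x\<^sup>2) *\<^sub>R (cpow x (- d) * v x) = 1 * cpow x (- d - 2) * v x"
      using that by (simp add: powr_diff scaleR_conv_of_real powr_numeral)
    finally show ?thesis .
  qed
  define Ws where "Ws = lp_prim (lp_mult 1 (- d - 2) ((0, b0) # vs))"
  have "expn (\<lambda>x. 1 * cpow x (- d - 2) * v x) (lp_mult 1 (- d - 2) ((0, b0) # vs)) (\<eta>2 - Re (- d - 2))"
    by (rule expn_mult) (rule vs)
  from expn_antiderivative[OF dW this] \<eta>2
  obtain C where "expn W ((0, [:C:]) # Ws) (\<eta>2 - Re (- d - 2) - 1)"
    unfolding Ws_def by auto
  moreover have "\<eta>2 - Re (- d - 2) - 1 = \<eta>2 + Re d + 1"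
    by simp
  ultimately have Ws: "expn W ((0, [:C:]) # Ws) (\<eta>2 + Re d + 1)"
    by (simp only:)

  \<comment> \<open>The zero part of \<open>F (R / n)\<close> in \<open>R\<close> is
    \<open>Q\<close> at \<open>ln R - ln n\<close>, with constant coefficient
    \<open>Q (- ln n)\<close>; \<open>W n\<close> stems from the lower endpoint 1.\<close>
  define G where "G = (\<lambda>n. cpow n (d + 1) * (poly Q (- complex_of_real (ln n)) + W n))"
  have LIM_int: "has_LIM_at_top (\<lambda>R. integral {1..R} (\<lambda>z. f (z, n))) (G n)" if n: "n > 0" for n
  proof -
    let ?c = "cpow n (d + 1)"
    have deriv: "((\<lambda>z. ?c * F (z / n)) has_vector_derivative f (z, n)) (at z)" if "z > 0" for z
    proof -
      have "((\<lambda>z. z / n) has_vector_derivative (1 / n)) (at z)"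
        using n unfolding has_real_derivative_iff_has_vector_derivative[symmetric]
        by (auto intro!: derivative_eq_intros)
      moreover have "(F has_vector_derivative u (z / n)) (at (z / n))"
        using n that by (intro F) simp
      ultimately have "(F \<circ> (\<lambda>z. z / n) has_vector_derivative (1 / n) *\<^sub>R u (z / n)) (at z)"
        by (rule vector_diff_chain_at)
      from has_vector_derivative_mult_right[OF this, of ?c]
      have "((\<lambda>z. ?c * F (z / n)) has_vector_derivative ?c * ((1 / n) *\<^sub>R u (z / n))) (at z)"
        by (simp only: o_def)
      also have "?c * ((1 / n) *\<^sub>R u (z / n)) = f (z, n)"
        using n that by (simp add: f_u powr_add scaleR_conv_of_real)
      finally show ?thesis .
    qed
    have int: "integral {1..R} (\<lambda>z. f (z, n)) = ?c * F (1 / n * R) + ?c * W n" if "R \<ge> 1" for R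
      using integral_eq_diff[OF that, of "\<lambda>z. ?c * F (z / n)" "\<lambda>z. f (z, n)"] deriv by (simp add: W_def)
    define xs where "xs = lp_mult ?c 0 (lp_scale (1 / n) Fs) @ [(0, [:?c * W n:])]"
    have "expn (\<lambda>R. ?c * F (1 / n * R) + ?c * W n) xs (\<eta>1 - 1)"
      unfolding xs_def
      by (intro expn_add expn_cmult expn_scale Fs expn_lp) (use n in auto)
    then have "expn (\<lambda>R. integral {1..R} (\<lambda>z. f (z, n))) xs (\<eta>1 - 1)"
      by (rule expn_cong[rotated]) (rule eventually_at_top_linorderI[of 1], rule int)
    moreover have "poly (zero_part xs) 0 = G n"
      using n by (simp add: xs_def G_def zero_part_lp_mult zero_part_lp_scale poly_pcompose Q_def ln_div algebra_simps)
    ultimately show ?thesis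
      using expn_imp_has_LIM_at_top[of _ xs "\<eta>1 - 1"] \<eta>1(1) by simp
  qed
  then have reg_G: "reg_integral_1_inf (\<lambda>z. f (z, n)) = G n" if "n > 0" for n
    using that unfolding reg_integral_1_inf_def by (intro LIM_at_top_eqI)
  have reg_int: "reg_integrable_1_inf (\<lambda>z. f (z, n))" if "n > 0" for n
    unfolding reg_integrable_1_inf_def LIM_exists_at_top_def using absint[OF that] LIM_int[OF that] by auto

  \<comment> \<open>For \<open>d = -1\<close> the equation for \<open>P\<close> fixes it only up to
    a constant, but \<open>C\<close> refers to the primitive built with this \<open>P\<close>, so
    \<open>C + poly P 0\<close> does not depend on the choice.\<close>
  define P where "P = poly_ode (- (d + 1)) b0"
  define L where "L = (if d = -1 then poly Q 0 + C else 0) + poly P 0"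
  have "has_LIM_at_top G L"
    unfolding G_def L_def P_def by (rule has_LIM_at_top_powr_antiderivative[OF Ws[unfolded Ws_def] vs(2) \<eta>2(1)])
  then obtain gs \<eta> where gs: "\<eta> > 0" "expn G gs \<eta>" "L = poly (zero_part gs) 0"
    by (rule has_LIM_at_top_imp_expn)
  have "expn (\<lambda>n. reg_integral_1_inf (\<lambda>z. f (z, n))) gs \<eta>"
    by (rule expn_cong[OF _ gs(2)]) (use eventually_gt_at_top[of 0] in eventually_elim, rule reg_G)
  from expn_imp_has_LIM_at_top[OF this gs(1)]
  have LHS: "has_LIM_at_top (\<lambda>n. reg_integral_1_inf (\<lambda>z. f (z, n))) L"
    by (simp add: gs(3))

  \<comment> \<open>By homogeneity \<open>f (z, n) = z^d * v (n / z)\<close>. The zero part of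
    \<open>v (n / z)\<close> is \<open>b0\<close> at \<open>ln n - ln z\<close>, with constant
    coefficient \<open>b0\<close> at \<open>- ln z\<close>.\<close>
  define h where "h = (\<lambda>z. cpow z d * poly (pcompose b0 [:0, -1:]) (complex_of_real (ln z)))"
  have LIM_h: "has_LIM_at_top (\<lambda>n. f (z, n)) (h z)" if z: "z \<ge> 1" for z
  proof -
    define xs where "xs = lp_mult (cpow z d) 0 (lp_scale (1 / z) ((0, b0) # vs))"
    have "expn (\<lambda>n. cpow z d * v (1 / z * n)) xs \<eta>2"
      unfolding xs_def by (intro expn_cmult expn_scale vs) (use z in simp)
    then have "expn (\<lambda>n. f (z, n)) xs \<eta>2"
      by (rule expn_cong[rotated])
         (use eventually_gt_at_top[of 0] in eventually_elim, use z in \<open>simp add: f_v\<close>)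
    moreover have "poly (zero_part xs) 0 = h z"
      using z zero_part_eq_0[OF vs(2)] by (simp add: xs_def h_def zero_part_lp_mult zero_part_lp_scale poly_pcompose ln_div)
    ultimately show ?thesis
      using expn_imp_has_LIM_at_top[of _ xs \<eta>2] \<eta>2(1) by simp
  qed
  define H where "H = (\<lambda>z. LIM_at_top (\<lambda>n. f (z, n)))"
  have H: "H z = h z" if "z \<ge> 1" for z
    unfolding H_def by (rule LIM_at_top_eqI[OF LIM_h[OF that]])
  \<comment> \<open>Reflecting the variable reverses the sign of the derivative, so minus the
    reflected \<open>P\<close> solves the equation for a primitive of \<open>h\<close>. Both sides
    of the identity thus share \<open>P\<close>.\<close>
  define q where "q = - pcompose P [:0, -1:]"
  have q: "smult (d + 1) q + pderiv q = pcompose b0 [:0, -1:]"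
  proof -
    have "b0 = smult (- (d + 1)) P + pderiv P"
      unfolding P_def poly_ode ..
    then have "pcompose b0 [:0, -1:] = smult (- (d + 1)) (pcompose P [:0, -1:]) + pcompose (pderiv P) [:0, -1:]"
      by (simp only: pcompose_add pcompose_smult)
    then show ?thesis
      by (simp add: q_def pderiv_pcompose pderiv_minus pderiv_pCons del: minus_add_distrib)
  qed
  have dh: "((\<lambda>z. cpow z (d + 1) * poly q (complex_of_real (ln z))) has_vector_derivative h z) (at z)" if "z > 0" for z
    using has_vector_derivative_cpow_poly_ln[OF that, of d q] unfolding q h_def .
  \<comment> \<open>With exponent \<open>d - 1\<close>, the function differentiated in
    \<open>has_vector_derivative_cpow_poly_ln\<close> is \<open>h\<close> itself.\<close>
  have "continuous_on {1..R} h" for R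
    unfolding h_def
    using has_vector_derivative_continuous[OF
        has_vector_derivative_cpow_poly_ln[of _ "d - 1" "pcompose b0 [:0, -1:]"]]
    by (intro continuous_at_imp_continuous_on) auto
  then have "h absolutely_integrable_on {1..R}" for R
    by (rule absolutely_integrable_continuous_real)
  then have absint_H: "H absolutely_integrable_on {1..R}" for R
    by (rule absolutely_integrable_spike[where S = "{}"]) (auto simp: H)
  have int_H: "integral {1..R} H = cpow R (d + 1) * poly q (complex_of_real (ln R)) - poly q 0" if "R \<ge> 1" for R
  proof -
    have "integral {1..R} H = integral {1..R} h"
      by (rule integral_cong) (simp add: H)
    then show ?thesis
      using integral_eq_diff[OF that, of _ h, OF dh] by simp
  qed
  \<comment> \<open>If \<open>d = -1\<close>, both entries have exponent 0 and their constant
    coefficients cancel. Otherwise only the boundary term at 1 remains, and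
    \<open>- poly q 0 = poly P 0\<close>.\<close>
  define xs where "xs = [(d + 1, q), (0, [:- poly q 0:])]"
  have "expn (\<lambda>R. cpow R (d + 1) * poly q (complex_of_real (ln R)) - poly q 0) xs 1"
    by (rule expn_lp) (simp add: xs_def)
  then have "expn (\<lambda>R. integral {1..R} H) xs 1"
    by (rule expn_cong[rotated]) (rule eventually_at_top_linorderI[of 1], rule int_H)
  from expn_imp_has_LIM_at_top[OF this]
  have LIM_int_H: "has_LIM_at_top (\<lambda>R. integral {1..R} H) (if d = -1 then 0 else poly P 0)"
    by (simp add: xs_def add_eq_0_iff2 q_def poly_pcompose split: if_splits)

  have zero: "has_LIM_at_0 (\<lambda>\<epsilon>. integral {\<epsilon>..1} u) (F 1 + C + poly P 0)" if d: "d = -1"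
  proof -
    have int: "integral {1 / x..1} u = F 1 + W x" if "x \<ge> 1" for x
    proof -
      have "1 / x \<le> 1" "1 / x > 0"
        using that by auto
      then have "integral {1 / x..1} u = F 1 - F (1 / x)"
        by (intro integral_eq_diff F) linarith+
      then show ?thesis
        by (simp add: W_def)
    qed
    define ys where "ys = [(0, [:F 1:])] @ (0, [:C:]) # Ws"
    have "expn (\<lambda>x. F 1 + W x) ys (\<eta>2 + Re d + 1)"
      unfolding ys_def by (intro expn_add Ws expn_lp) simp
    then have "expn (\<lambda>x. integral {1 / x..1} u) ys (\<eta>2 + Re d + 1)"
      by (rule expn_cong[rotated]) (rule eventually_at_top_linorderI[of 1], rule int)
    \<comment> \<open>The exponents here are \<open>s - d - 1\<close>, which for
      \<open>d = -1\<close> are the non-zero exponents of \<open>vs\<close> again.\<close>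
    moreover have "zero_part (lp_prim (lp_mult 1 (- d - 2) vs)) = 0"
      using vs(2) d by (intro zero_part_eq_0) (auto simp: lp_mult_def lp_prim_def image_iff)
    then have "poly (zero_part ys) 0 = F 1 + C + poly P 0"
      using d by (simp add: ys_def Ws_def P_def lp_mult_def lp_prim_def)
    ultimately have "has_LIM_at_top (\<lambda>x. integral {1 / x..1} u) (F 1 + C + poly P 0)"
      using expn_imp_has_LIM_at_top[of _ ys "\<eta>2 + Re d + 1"] \<eta>2 by simp
    then have "has_LIM_at_0 (\<lambda>x. integral {1 / (1 / x)..1} u) (F 1 + C + poly P 0)"
      by (rule has_LIM_at_0_inverse_iff[THEN iffD2])
    then show ?thesis by simp
  qed
  have reg_0_inf: "reg_integrable_0_inf u" if "d = -1"
    using reg_int[of 1] absint[of 1] zero[OF that]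
    unfolding reg_integrable_0_inf_def reg_integrable_0_1_def LIM_exists_at_0_def u_def by auto
  \<comment> \<open>The integral from 1 on is \<open>G 1 = poly Q 0 - F 1\<close>, and
    \<open>F 1\<close> cancels against the upper endpoint of the integral near 0.\<close>
  have "reg_integral_0_inf u = poly Q 0 + C + poly P 0" if "d = -1"
    using reg_G[of 1] LIM_at_0_eqI[OF zero[OF that]] that
    by (simp add: reg_integral_0_inf_def reg_integral_0_1_def G_def W_def flip: u_def)
  moreover have "reg_integral_1_inf H = (if d = -1 then 0 else poly P 0)"
    unfolding reg_integral_1_inf_def by (rule LIM_at_top_eqI[OF LIM_int_H])
  ultimately have "L = reg_integral_1_inf H + (if d = -1 then reg_integral_0_inf u else 0)"
    by (simp add: L_def)
  then have "LIM_at_top (\<lambda>n. reg_integral_1_inf (\<lambda>z. f (z, n))) =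
      reg_integral_1_inf H + (if d = -1 then reg_integral_0_inf u else 0)"
    using LIM_at_top_eqI[OF LHS] by simp
  moreover have "reg_integrable_1_inf H"
    unfolding reg_integrable_1_inf_def LIM_exists_at_top_def using absint_H LIM_int_H by blast
  ultimately show ?thesis
    using reg_int LHS LIM_h reg_0_inf
    unfolding H_def u_def LIM_exists_at_top_def by blast
qed

end
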